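(* Let $1<p<\infty$, let $v$ be a weight function on $\mathbb{R}$, and let $\phi\in L^1(\mathbb{R})$. Put $$A_{\sup}:=\int_{\mathbb{R}} \frac{|\phi(t)|}{|t|^{2\alpha+2-\frac1p}}\left(\sup_{y\in\mathbb{R}}\frac{v(ty)}{v(y)}\right)^{1/p}dt,\qquad A_{\inf}:=\int_{\mathbb{R}} \frac{|\phi(t)|}{|t|^{2\alpha+2-\frac1p}}\left(\inf_{y\in\mathbb{R}}\frac{v(ty)}{v(y)}\right)^{1/p}dt .$$ If there exists a function $h$ such that $v(xy)=v(x)h(y)$, then $A_{\sup}=A_{\inf}$ and $$\|H_{\alpha,\phi}\|_{L^p_v(\mathbb{R})\to L^p_v(\mathbb{R})}=\int_{\mathbb{R}} \frac{|\phi(t)|}{|t|^{2\alpha+2-\frac1p}}\,h^{1/p}(t)\,dt .$$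
   Context: A weight function is a function which is measurable, positive and finite almost everywhere on its domain. $L^p_v(\mathbb{R})$ is the weighted Lebesgue space with norm $\|f\|_{L^p_v(\mathbb{R})}=\left(\int_{\mathbb{R}}|f(x)|^p v(x)\,dx\right)^{1/p}$. For a real parameter $\alpha$ and $\phi\in L^1(\mathbb{R})$, the Dunkl-Hausdorff operator is $$H_{\alpha,\phi}f(x)=\int_{\mathbb{R}}\frac{|\phi(t)|}{|t|^{2\alpha+2}}f\left(\frac{x}{t}\right)dt ,$$ and $\|H_{\alpha,\phi}\|_{L^p_v(\mathbb{R})\to L^p_v(\mathbb{R})}$ denotes its operator norm. In the condition $v(xy)=v(x)h(y)$, $x$ and $y$ are real variables. *)

theory Defs
  imports "HOL-Analysis.Analysis"
begin

(* Throughout, scalars have a type of sort {real_normed_field, banach, second_countable_topology};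
   real and complex are instances. *)

(* Only used with a > 0, so that infinity powr a = infinity and 0 powr a = 0. *)
definition ennreal_powr :: "ennreal \<Rightarrow> real \<Rightarrow> ennreal" where
  "ennreal_powr x a = (if x = \<infinity> then \<infinity> else ennreal (enn2real x powr a))"

(* Weights take extended real values: "positive and finite" is only required almost everywhere.
   Values on the exceptional null set are unrestricted (for instance \<bar>x\<bar> powr c at 0 with c < 0
   may be infinity). *)
definition weight_function :: "(real \<Rightarrow> ereal) \<Rightarrow> bool" where
  "weight_function v \<longleftrightarrow>
     v \<in> borel_measurable lebesgue \<and> (AE x in lebesgue. 0 < v x \<and> v x < \<infinity>)"

(* e2ennreal truncates negative values to 0; for a weight this concerns a null set only. *)
definition wnorm :: "real \<Rightarrow> (real \<Rightarrow> ereal) \<Rightarrow> (real \<Rightarrow> 'a::real_normed_vector) \<Rightarrow> ennreal" where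
  "wnorm p v f =
     ennreal_powr (\<integral>\<^sup>+ x. ennreal (norm (f x) powr p) * e2ennreal (v x) \<partial>lebesgue) (1 / p)"

definition weighted_Lp :: "real \<Rightarrow> (real \<Rightarrow> ereal) \<Rightarrow> (real \<Rightarrow> 'a::real_normed_vector) set" where
  "weighted_Lp p v = {f. f \<in> borel_measurable lebesgue \<and> wnorm p v f < \<infinity>}"

definition dh_integrand ::
  "real \<Rightarrow> (real \<Rightarrow> 'a::{real_normed_field,banach,second_countable_topology}) \<Rightarrow> (real \<Rightarrow> 'a) \<Rightarrow> real \<Rightarrow> real \<Rightarrow> 'a" where
  "dh_integrand \<alpha> \<phi> f x t = (norm (\<phi> t) / \<bar>t\<bar> powr (2 * \<alpha> + 2)) *\<^sub>R f (x / t)"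

definition dunkl_hausdorff ::
  "real \<Rightarrow> (real \<Rightarrow> 'a::{real_normed_field,banach,second_countable_topology}) \<Rightarrow> (real \<Rightarrow> 'a) \<Rightarrow> real \<Rightarrow> 'a" where
  "dunkl_hausdorff \<alpha> \<phi> f x = (LINT t|lebesgue. dh_integrand \<alpha> \<phi> f x t)"

(* The Bochner integral is 0 where the integrand is not integrable, so that "the integral defining
   the operator exists (almost everywhere)" has to be recorded separately. *)
definition dunkl_hausdorff_defined ::
  "real \<Rightarrow> (real \<Rightarrow> 'a::{real_normed_field,banach,second_countable_topology}) \<Rightarrow> (real \<Rightarrow> 'a) \<Rightarrow> bool" where
  "dunkl_hausdorff_defined \<alpha> \<phi> f \<longleftrightarrow> (AE x in lebesgue. integrable lebesgue (dh_integrand \<alpha> \<phi> f x))"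

(* The operator norm on weighted_Lp p v of an operator T that makes sense on the functions
   satisfying D: the least admissible constant, and infinity if there is no finite one (in
   particular if T is not defined on all of the space or does not map the space into itself). *)
definition weighted_op_norm ::
  "real \<Rightarrow> (real \<Rightarrow> ereal) \<Rightarrow> ((real \<Rightarrow> 'a::real_normed_vector) \<Rightarrow> bool)
     \<Rightarrow> ((real \<Rightarrow> 'a) \<Rightarrow> real \<Rightarrow> 'a) \<Rightarrow> ennreal" where
  "weighted_op_norm p v D T =
     Inf {C. \<forall>f \<in> weighted_Lp p v.
            D f \<and> T f \<in> weighted_Lp p v \<and> wnorm p v (T f) \<le> C * wnorm p v f}"

definition dunkl_hausdorff_norm ::
  "real \<Rightarrow> (real \<Rightarrow> ereal) \<Rightarrow> real
     \<Rightarrow> (real \<Rightarrow> 'a::{real_normed_field,banach,second_countable_topology}) \<Rightarrow> ennreal" where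
  "dunkl_hausdorff_norm p v \<alpha> \<phi> =
     weighted_op_norm p v (dunkl_hausdorff_defined \<alpha> \<phi>) (dunkl_hausdorff \<alpha> \<phi>)"

definition dh_integral :: "real \<Rightarrow> real \<Rightarrow> (real \<Rightarrow> 'a::real_normed_vector) \<Rightarrow> (real \<Rightarrow> ereal) \<Rightarrow> ennreal" where
  "dh_integral p \<alpha> \<phi> g =
     (\<integral>\<^sup>+ t. ennreal (norm (\<phi> t) / \<bar>t\<bar> powr (2 * \<alpha> + 2 - 1 / p))
            * ennreal_powr (e2ennreal (g t)) (1 / p) \<partial>lebesgue)"

(* The quotients v (t * y) / v y are taken over those y for which v y is positive and finite:
   already for v x = \<bar>x\<bar> powr c the quotient at y = 0 is 0 / 0 or infinity / infinity. *)
definition A_sup :: "real \<Rightarrow> (real \<Rightarrow> ereal) \<Rightarrow> real \<Rightarrow> (real \<Rightarrow> 'a::real_normed_vector) \<Rightarrow> ennreal" where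
  "A_sup p v \<alpha> \<phi> = dh_integral p \<alpha> \<phi> (\<lambda>t. SUP y\<in>{y. 0 < v y \<and> v y < \<infinity>}. v (t * y) / v y)"

definition A_inf :: "real \<Rightarrow> (real \<Rightarrow> ereal) \<Rightarrow> real \<Rightarrow> (real \<Rightarrow> 'a::real_normed_vector) \<Rightarrow> ennreal" where
  "A_inf p v \<alpha> \<phi> = dh_integral p \<alpha> \<phi> (\<lambda>t. INF y\<in>{y. 0 < v y \<and> v y < \<infinity>}. v (t * y) / v y)"

end

theory Submission
  imports Defs
begin

text \<open>
  If \<open>v (x * y) = v x * h y\<close>, then every admissible quotient \<open>v (t * y) / v y\<close> equals \<open>h t\<close>, so
  the supremum and the infimum coincide. The content is the formula for the norm.

  The functional equation makes \<open>h\<close> a positive homomorphism of the multiplicative group of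
  nonzero reals, and \<open>v = v 1 * h\<close> there (\<open>multiplicative_ereal_weight\<close>). Put
  \<open>u x = (\<bar>x\<bar> * h x) powr (1 / p)\<close>, again a homomorphism. The substitution \<open>F = f * u\<close> identifies
  the weighted space, up to a constant factor in the norm, with the \<open>L^p\<close> space of the Haar measure
  \<open>dx / \<bar>x\<bar>\<close>, and the Dunkl-Hausdorff operator becomes the map sending \<open>F\<close> to the function
  \<open>x \<mapsto> \<integral> M t * F (x / t) dt\<close> with the nonnegative kernel
  \<open>M t = norm (\<phi> t) / \<bar>t\<bar> powr (2 * \<alpha> + 2) * u t\<close>. This is a multiplicative convolution, and the
  integral of \<open>M\<close> is the constant in the theorem.

  The norm is at most the integral of \<open>M\<close> by Jensen's inequality, Tonelli's theorem and the
  invariance of Haar measure (\<open>mult_convolution_bound\<close>, \<open>dunkl_hausdorff_bounded\<close>). It is at least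
  that because the kernel is nonnegative and the group is amenable: indicators of the annuli
  \<open>exp (- m) \<le> \<bar>x\<bar> \<le> exp m\<close> have Haar measure \<open>4 * m\<close>, and convolving with the part of \<open>M\<close> on
  the annulus of logarithmic radius \<open>j\<close> multiplies the indicator by the mass of that part except near
  the ends, a set of measure \<open>4 * j\<close> on the inside, which is negligible as \<open>m\<close> tends to infinity
  (\<open>annulus_mass_test_inequality\<close>, \<open>mass_le_admissible_constant\<close>).
\<close>

section \<open>Powers of extended nonnegative reals\<close>

lemma ennreal_powr_ennreal: "0 \<le> x \<Longrightarrow> ennreal_powr (ennreal x) a = ennreal (x powr a)"
  by (simp add: ennreal_powr_def)

lemma ennreal_powr_mono: "0 \<le> a \<Longrightarrow> x \<le> y \<Longrightarrow> ennreal_powr x a \<le> ennreal_powr y a"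
  by (cases x; cases y) (auto simp: ennreal_powr_def top_unique ennreal_leI powr_mono2)

lemma ennreal_powr_powr: "ennreal_powr (ennreal_powr x a) b = ennreal_powr x (a * b)"
  by (cases x) (auto simp: ennreal_powr_def powr_powr)

lemma ennreal_powr_one [simp]: "ennreal_powr x 1 = x"
  by (cases x) (auto simp: ennreal_powr_def)

lemma ennreal_powr_mult: "ennreal_powr (x * y) a = ennreal_powr x a * ennreal_powr y a"
proof (cases x; cases y)
  fix r s assume "0 \<le> r" "x = ennreal r" "0 \<le> s" "y = ennreal s"
  then show ?thesis
    by (simp add: ennreal_powr_ennreal powr_mult flip: ennreal_mult)
next
  fix r assume r: "0 \<le> r" "x = ennreal r" "y = top"
  then show ?thesis
    by (cases "r = 0") (auto simp: ennreal_powr_def ennreal_mult_top)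
next
  fix r assume r: "0 \<le> r" "y = ennreal r" "x = top"
  then show ?thesis
    by (cases "r = 0") (auto simp: ennreal_powr_def ennreal_top_mult)
qed (auto simp: ennreal_powr_def)

lemma ennreal_powr_less_top: "x < top \<Longrightarrow> ennreal_powr x a < top"
  by (auto simp: ennreal_powr_def)

lemma ennreal_powr_root_le_iff:
  assumes "0 < p"
  shows "ennreal_powr x (1 / p) \<le> y \<longleftrightarrow> x \<le> ennreal_powr y p"
  using ennreal_powr_mono[of p "ennreal_powr x (1 / p)" y]
        ennreal_powr_mono[of "1 / p" x "ennreal_powr y p"] assms
  by (auto simp: ennreal_powr_powr)

lemma measurable_ennreal_powr [measurable]:
  assumes [measurable]: "f \<in> borel_measurable M"
  shows "(\<lambda>x. ennreal_powr (f x) a) \<in> borel_measurable M"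
proof -
  have "f -` {top} \<inter> space M \<in> sets M"
    by measurable
  then have "{x \<in> space M. f x = top} \<in> sets M"
    by (simp add: vimage_def Int_def conj_commute)
  moreover have "(\<lambda>x. ennreal (enn2real (f x) powr a)) \<in> borel_measurable M"
    by measurable
  ultimately show ?thesis
    unfolding ennreal_powr_def infinity_ennreal_def by (intro measurable_If) simp_all
qed

section \<open>Lebesgue measurable functions and their Borel versions\<close>

lemma lebesgue_measurable_ident: "(\<lambda>x::real. x) \<in> borel_measurable lebesgue"
  by (rule measurable_completion) simp

lemma AE_lebesgue_nonzero: "AE x in lebesgue. x \<noteq> (0::real)"
  by (rule AE_completion[OF AE_lborel_singleton])

lemma AE_lebesgue_imp_ex_open:
  fixes S :: "'b::euclidean_space set"
  assumes "AE x in lebesgue. P x" "open S" "S \<noteq> {}"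
  obtains x where "x \<in> S" "P x"
proof (rule ccontr)
  assume "\<not> thesis"
  then have "S \<subseteq> {x. \<not> P x}"
    using that by auto
  moreover have "negligible {x. \<not> P x}"
    using assms(1) by (simp add: completion.AE_iff_null_sets negligible_iff_null_sets)
  ultimately show False
    using open_not_negligible[OF assms(2,3)] negligible_subset by blast
qed

text \<open>The map \<open>t \<mapsto> x / t\<close> is its own inverse and differentiable off \<open>0\<close>, so it pulls
  null sets back to null sets.\<close>

lemma AE_lebesgue_divide:
  fixes x :: real
  assumes "AE y in lebesgue. P y" "x \<noteq> 0"
  shows "AE t in lebesgue. P (x / t)"
proof -
  let ?N = "{y. \<not> P y} - {0}"
  have "negligible {y. \<not> P y}"
    using assms(1) by (simp add: completion.AE_iff_null_sets negligible_iff_null_sets)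
  then have "negligible ?N"
    by (rule negligible_subset) auto
  moreover have "(\<lambda>s. x / s) differentiable_on ?N"
    by (auto simp: differentiable_on_def intro!: differentiable_divide)
  ultimately have "negligible ((\<lambda>s. x / s) ` ?N)"
    by (intro negligible_differentiable_image_negligible) auto
  then have "negligible (insert 0 ((\<lambda>s. x / s) ` ?N))"
    by (simp add: negligible_insert)
  moreover have "{t. \<not> P (x / t)} \<subseteq> insert 0 ((\<lambda>s. x / s) ` ?N)"
  proof
    fix t assume "t \<in> {t. \<not> P (x / t)}"
    then show "t \<in> insert 0 ((\<lambda>s. x / s) ` ?N)"
      using \<open>x \<noteq> 0\<close> by (cases "t = 0") (auto intro!: image_eqI[of t _ "x / t"])
  qed
  ultimately have "negligible {t. \<not> P (x / t)}"
    by (rule negligible_subset)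
  then show ?thesis
    by (simp add: completion.AE_iff_null_sets negligible_iff_null_sets)
qed

text \<open>Tonelli's theorem and the measurability of parameter integrals live on the product of two
  Borel measures, since the product of two Lebesgue measures is not complete and \<open>f (x / t)\<close> need
  not be measurable on it. A Lebesgue measurable function is therefore first replaced by a Borel
  one: approximate it by simple functions and correct each of these on a null set.\<close>

lemma completion_ex_borel_measurable_banach:
  fixes f :: "'b \<Rightarrow> 'c::{banach,second_countable_topology}"
  assumes "f \<in> borel_measurable (completion M)"
  obtains g where "g \<in> borel_measurable M" "AE x in M. f x = g x"
proof -
  obtain s where s: "\<And>i. simple_function (completion M) (s i)"
      "\<And>x. x \<in> space M \<Longrightarrow> (\<lambda>i. s i x) \<longlonglongrightarrow> f x"
    using borel_measurable_implies_sequence_metric[OF assms, of 0] by auto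
  obtain s' where s': "\<And>i. simple_function M (s' i)" "\<And>i. AE x in M. s i x = s' i x"
    using completion_ex_simple_function[OF s(1)] by metis
  show ?thesis
  proof
    show "(\<lambda>x. lim (\<lambda>i. s' i x)) \<in> borel_measurable M"
      using s'(1) by (intro borel_measurable_lim_metric borel_measurable_simple_function)
    have "AE x in M. \<forall>i. s i x = s' i x"
      using s'(2) by (simp add: AE_all_countable)
    then show "AE x in M. f x = lim (\<lambda>i. s' i x)"
    proof (rule AE_mp, intro AE_I2 impI)
      fix x assume "x \<in> space M" "\<forall>i. s i x = s' i x"
      with s(2)[of x] show "f x = lim (\<lambda>i. s' i x)"
        by (simp add: limI)
    qed
  qed
qed

lemma lebesgue_measurable_ex_borel:
  fixes f :: "'b::euclidean_space \<Rightarrow> 'c::{banach,second_countable_topology}"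
  assumes "f \<in> borel_measurable lebesgue"
  obtains g where "g \<in> borel_measurable borel" "AE x in lebesgue. f x = g x"
  using completion_ex_borel_measurable_banach[OF assms] by (auto intro: AE_completion)

text \<open>The way back: completeness of Lebesgue measure carries measurability from the Borel
  version to the original function.\<close>

lemma borel_measurable_lebesgue_cong_AE:
  fixes f g :: "real \<Rightarrow> 'b::{banach,second_countable_topology}"
  assumes "g \<in> borel_measurable borel" "AE x in lebesgue. f x = g x"
  shows "f \<in> borel_measurable lebesgue"
proof (rule measurableI)
  fix A :: "'b set" assume A: "A \<in> sets borel"
  have g: "g -` A \<inter> space lebesgue \<in> sets lebesgue"
    using measurable_sets[OF measurable_completion[of g lborel borel] A] assms(1) by simp
  have "AE x in lebesgue. x \<in> g -` A \<inter> space lebesgue \<longleftrightarrow> x \<in> f -` A \<inter> space lebesgue"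
    using assms(2) by eventually_elim simp
  then show "f -` A \<inter> space lebesgue \<in> sets lebesgue"
    by (rule completion.in_sets_AE) (use g in auto)
qed simp

section \<open>Multiplicative convolution on the line\<close>

text \<open>The convex function \<open>s \<mapsto> s powr p\<close> lies above its tangent at \<open>a\<close>; this is Young's
  inequality for \<open>s\<close> and \<open>a powr (p - 1)\<close>.\<close>

lemma powr_tangent_le:
  fixes a s p :: real
  assumes "1 < p" "0 \<le> a" "0 \<le> s"
  shows "p * a powr (p - 1) * s \<le> s powr p + (p - 1) * a powr p"
proof -
  define q where "q = p / (p - 1)"
  have "s * a powr (p - 1) \<le> s powr p / p + (a powr (p - 1)) powr q / q"
    using assms by (intro Youngs_inequality) (auto simp: q_def field_simps)
  also have "(a powr (p - 1)) powr q / q = (p - 1) * a powr p / p"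
    using assms by (simp add: q_def powr_powr)
  finally have "p * (s * a powr (p - 1)) \<le> p * (s powr p / p + (p - 1) * a powr p / p)"
    using assms by (intro mult_left_mono) auto
  also have "\<dots> = s powr p + (p - 1) * a powr p"
    using assms by (simp add: field_simps)
  finally show ?thesis by (simp add: mult_ac)
qed

text \<open>Jensen's inequality for \<open>x \<mapsto> x powr p\<close> and the measure with density \<open>m\<close>, not normalised to
  total mass one, with both sides allowed to be infinite. It follows by integrating the tangent
  inequality; if the left side is infinite, any single tangent shows that the right side is.\<close>

lemma nn_integral_Jensen_powr:
  fixes m g :: "'b \<Rightarrow> real"
  assumes [measurable]: "m \<in> borel_measurable N" "g \<in> borel_measurable N"
    and nonneg: "\<And>t. 0 \<le> m t" "\<And>t. 0 \<le> g t" and "1 < p"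
    and fin: "(\<integral>\<^sup>+ t. ennreal (m t) \<partial>N) < \<infinity>"
  shows "ennreal_powr (\<integral>\<^sup>+ t. ennreal (m t * g t) \<partial>N) p
    \<le> ennreal_powr (\<integral>\<^sup>+ t. ennreal (m t) \<partial>N) (p - 1) * (\<integral>\<^sup>+ t. ennreal (m t * g t powr p) \<partial>N)"
    (is "ennreal_powr ?S p \<le> ennreal_powr ?A (p - 1) * ?J")
proof -
  obtain A where A: "?A = ennreal A" "0 \<le> A"
    using fin by (cases ?A) auto
  have tangent: "ennreal (p * a powr (p - 1)) * ?S \<le> ?J + ennreal ((p - 1) * a powr p) * ?A"
    if "0 \<le> a" for a
  proof -
    have "ennreal (p * a powr (p - 1)) * ?S = (\<integral>\<^sup>+ t. ennreal (p * a powr (p - 1) * (m t * g t)) \<partial>N)"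
      using nonneg \<open>1 < p\<close> by (simp add: ennreal_mult nn_integral_cmult)
    also have "\<dots> \<le> (\<integral>\<^sup>+ t. ennreal (m t * g t powr p) + ennreal ((p - 1) * a powr p) * ennreal (m t) \<partial>N)"
    proof (intro nn_integral_mono)
      fix t
      have "m t * (p * a powr (p - 1) * g t) \<le> m t * (g t powr p + (p - 1) * a powr p)"
        using nonneg \<open>1 < p\<close> that by (intro mult_left_mono powr_tangent_le) auto
      then have "p * a powr (p - 1) * (m t * g t) \<le> m t * g t powr p + (p - 1) * a powr p * m t"
        by (simp only: algebra_simps)
      then have "ennreal (p * a powr (p - 1) * (m t * g t))
          \<le> ennreal (m t * g t powr p + (p - 1) * a powr p * m t)"
        by (rule ennreal_leI)
      also have "\<dots> = ennreal (m t * g t powr p) + ennreal ((p - 1) * a powr p) * ennreal (m t)"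
        using nonneg \<open>1 < p\<close> by (simp add: ennreal_mult)
      finally show "ennreal (p * a powr (p - 1) * (m t * g t))
          \<le> ennreal (m t * g t powr p) + ennreal ((p - 1) * a powr p) * ennreal (m t)" .
    qed
    also have "\<dots> = ?J + ennreal ((p - 1) * a powr p) * ?A"
      by (simp add: nn_integral_add nn_integral_cmult)
    finally show ?thesis .
  qed
  consider "A = 0" | "0 < A" "?J = \<infinity>" | "0 < A" "?J < \<infinity>"
    using A(2) by (metis infinity_ennreal_def less_eq_real_def less_top)
  then show ?thesis
  proof cases
    case 1
    then have "AE t in N. ennreal (m t) = 0"
      using A by (simp add: nn_integral_0_iff_AE)
    then have "AE t in N. ennreal (m t * g t) = 0"
      by (rule eventually_mono) (simp add: ennreal_mult nonneg)
    then have "?S = 0"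
      by (simp add: nn_integral_0_iff_AE)
    then show ?thesis by (simp add: ennreal_powr_def)
  next
    case 2
    then show ?thesis
      using A by (simp add: ennreal_powr_ennreal ennreal_mult_top)
  next
    case 3
    then obtain J where J: "?J = ennreal J" "0 \<le> J"
      by (cases ?J) auto
    have "?S \<noteq> \<infinity>"
    proof
      assume "?S = \<infinity>"
      with tangent[of 1] A J \<open>1 < p\<close> show False
        by (auto simp: ennreal_mult_top top_unique simp flip: ennreal_mult ennreal_plus)
    qed
    then obtain S where S: "?S = ennreal S" "0 \<le> S"
      by (cases ?S) auto
    \<comment> \<open>The tangent at the mean value of \<open>g\<close> is the one that gives equality for constant \<open>g\<close>.\<close>
    define a where "a = S / A"
    have a: "0 \<le> a" "S = a * A"
      using S A 3 by (auto simp: a_def)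
    have "p * a powr (p - 1) * S \<le> J + (p - 1) * a powr p * A"
      using tangent[OF a(1)] A J S \<open>1 < p\<close>
      by (simp flip: ennreal_mult ennreal_plus)
    moreover have "a powr p = a powr (p - 1) * a"
      using a \<open>1 < p\<close> by (cases "a = 0") (auto simp: powr_diff)
    ultimately have "a powr p * A \<le> J"
      by (simp add: a(2) algebra_simps)
    then have "A powr (p - 1) * (a powr p * A) \<le> A powr (p - 1) * J"
      by (intro mult_left_mono) auto
    moreover have "S powr p = A powr (p - 1) * (a powr p * A)"
      using a 3 by (simp add: powr_mult powr_diff)
    ultimately show ?thesis
      using A J S by (simp add: ennreal_powr_ennreal ennreal_leI flip: ennreal_mult)
  qed
qed

text \<open>The measure \<open>dx / \<bar>x\<bar>\<close> is the Haar measure of the multiplicative group of nonzero reals.\<close>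

lemma nn_integral_mult_invariant:
  assumes [measurable]: "G \<in> borel_measurable borel" and "t \<noteq> 0"
  shows "(\<integral>\<^sup>+ x. G (x / t) * ennreal (1 / \<bar>x\<bar>) \<partial>lborel)
    = (\<integral>\<^sup>+ x. G x * ennreal (1 / \<bar>x::real\<bar>) \<partial>lborel)"
proof -
  have "(\<integral>\<^sup>+ x. G x * ennreal (1 / \<bar>x\<bar>) \<partial>lborel)
      = ennreal \<bar>1 / t\<bar> * (\<integral>\<^sup>+ x. G (x / t) * ennreal (1 / \<bar>x / t\<bar>) \<partial>lborel)"
    using nn_integral_real_affine[of "\<lambda>x. G x * ennreal (1 / \<bar>x\<bar>)" "1 / t" 0] \<open>t \<noteq> 0\<close> by simp
  also have "\<dots> = (\<integral>\<^sup>+ x. ennreal \<bar>1 / t\<bar> * (G (x / t) * ennreal (1 / \<bar>x / t\<bar>)) \<partial>lborel)"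
    by (rule nn_integral_cmult[symmetric]) measurable
  also have "\<dots> = (\<integral>\<^sup>+ x. G (x / t) * ennreal (1 / \<bar>x\<bar>) \<partial>lborel)"
  proof (intro nn_integral_cong)
    fix x :: real
    have "ennreal \<bar>1 / t\<bar> * ennreal (1 / \<bar>x / t\<bar>) = ennreal (1 / \<bar>x\<bar>)"
      using \<open>t \<noteq> 0\<close> by (simp add: abs_divide flip: ennreal_mult)
    then show "ennreal \<bar>1 / t\<bar> * (G (x / t) * ennreal (1 / \<bar>x / t\<bar>)) = G (x / t) * ennreal (1 / \<bar>x\<bar>)"
      by (metis mult.commute mult.left_commute)
  qed
  finally show ?thesis by simp
qed

text \<open>Young's inequality \<open>L^1 * L^p \<subseteq> L^p\<close> on the multiplicative group. Jensen's inequality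
  moves the power inside the inner integral, after which Tonelli's theorem and the invariance of
  \<open>dx / \<bar>x\<bar>\<close> separate the two integrals.\<close>

lemma mult_convolution_bound:
  fixes M F :: "real \<Rightarrow> real"
  assumes [measurable]: "M \<in> borel_measurable borel" "F \<in> borel_measurable borel"
    and nonneg: "\<And>t. 0 \<le> M t" "\<And>t. 0 \<le> F t" and "1 < p"
    and fin: "(\<integral>\<^sup>+ t. ennreal (M t) \<partial>lborel) < \<infinity>"
  shows "(\<integral>\<^sup>+ x. ennreal_powr (\<integral>\<^sup>+ t. ennreal (M t * F (x / t)) \<partial>lborel) p * ennreal (1 / \<bar>x\<bar>) \<partial>lborel)
    \<le> ennreal_powr (\<integral>\<^sup>+ t. ennreal (M t) \<partial>lborel) p * (\<integral>\<^sup>+ x. ennreal (F x powr p) * ennreal (1 / \<bar>x\<bar>) \<partial>lborel)"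
    (is "?L \<le> ennreal_powr ?A p * ?I")
proof -
  have "?L \<le> (\<integral>\<^sup>+ x. ennreal_powr ?A (p - 1) * (\<integral>\<^sup>+ t. ennreal (M t * F (x / t) powr p) \<partial>lborel)
      * ennreal (1 / \<bar>x\<bar>) \<partial>lborel)"
    using assms by (intro nn_integral_mono mult_right_mono nn_integral_Jensen_powr) auto
  also have "\<dots> = (\<integral>\<^sup>+ x. ennreal_powr ?A (p - 1) * (\<integral>\<^sup>+ t. ennreal (M t) * (ennreal (F (x / t) powr p)
      * ennreal (1 / \<bar>x\<bar>)) \<partial>lborel) \<partial>lborel)"
    using nonneg by (simp add: ennreal_mult mult.assoc flip: nn_integral_multc)
  also have "\<dots> = ennreal_powr ?A (p - 1) * (\<integral>\<^sup>+ x. (\<integral>\<^sup>+ t. ennreal (M t) * (ennreal (F (x / t) powr p)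
      * ennreal (1 / \<bar>x\<bar>)) \<partial>lborel) \<partial>lborel)"
    by (rule nn_integral_cmult) measurable
  also have "(\<integral>\<^sup>+ x. (\<integral>\<^sup>+ t. ennreal (M t) * (ennreal (F (x / t) powr p) * ennreal (1 / \<bar>x\<bar>)) \<partial>lborel) \<partial>lborel)
      = (\<integral>\<^sup>+ t. (\<integral>\<^sup>+ x. ennreal (M t) * (ennreal (F (x / t) powr p) * ennreal (1 / \<bar>x\<bar>)) \<partial>lborel) \<partial>lborel)"
    by (rule lborel_pair.Fubini') measurable
  also have "\<dots> = (\<integral>\<^sup>+ t. ennreal (M t) * ?I \<partial>lborel)"
  proof (rule nn_integral_cong_AE, use AE_lborel_singleton[of 0] in eventually_elim)
    fix t :: real assume "t \<noteq> 0"
    then show "(\<integral>\<^sup>+ x. ennreal (M t) * (ennreal (F (x / t) powr p) * ennreal (1 / \<bar>x\<bar>)) \<partial>lborel)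
        = ennreal (M t) * ?I"
      by (simp add: nn_integral_cmult nn_integral_mult_invariant[of "\<lambda>x. ennreal (F x powr p)"])
  qed
  also have "\<dots> = ?A * ?I"
    by (rule nn_integral_multc) measurable
  also have "ennreal_powr ?A (p - 1) * (?A * ?I) = ennreal_powr ?A p * ?I"
  proof -
    obtain A where A: "?A = ennreal A" "0 \<le> A"
      using fin by (cases ?A) auto
    then have "A powr (p - 1) * A = A powr p"
      using \<open>1 < p\<close> by (cases "A = 0") (auto simp: powr_diff)
    then have "ennreal_powr ?A (p - 1) * ?A = ennreal_powr ?A p"
      using A by (simp add: ennreal_powr_ennreal flip: ennreal_mult)
    then show ?thesis by (simp flip: mult.assoc)
  qed
  finally show ?thesis .
qed

text \<open>The Haar measure of an annulus grows linearly in the logarithm \<open>m\<close> of its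
  outer radius. The linear growth is what makes the loss at the ends of the annulus negligible in the
  lower bound for the operator norm.\<close>

lemma nn_integral_inverse_annulus:
  assumes "0 \<le> m"
  shows "(\<integral>\<^sup>+ x. indicator {x. exp (- m) \<le> \<bar>x\<bar> \<and> \<bar>x\<bar> \<le> exp m} x * ennreal (1 / \<bar>x\<bar>) \<partial>lborel)
    = ennreal (4 * m)"
proof -
  let ?I = "{exp (- m)..exp m}"
  have pos: "(\<integral>\<^sup>+ x. ennreal (1 / \<bar>x\<bar>) * indicator ?I x \<partial>lborel) = ennreal (2 * m)"
  proof -
    have "(\<integral>\<^sup>+ x. ennreal (1 / \<bar>x\<bar>) * indicator ?I x \<partial>lborel) = ennreal (ln (exp m) - ln (exp (- m)))"
    proof (rule nn_integral_FTC_Icc)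
      fix x assume "x \<in> ?I"
      moreover have "0 < exp (- m)" by simp
      ultimately have "0 < x" by (metis atLeastAtMost_iff less_le_trans)
      then show "(ln has_real_derivative 1 / \<bar>x\<bar>) (at x)"
        by (auto intro!: derivative_eq_intros)
    qed (use assms in auto)
    then show ?thesis by simp
  qed
  have "(\<integral>\<^sup>+ x. indicator {x. exp (- m) \<le> \<bar>x\<bar> \<and> \<bar>x\<bar> \<le> exp m} x * ennreal (1 / \<bar>x\<bar>) \<partial>lborel)
      = (\<integral>\<^sup>+ x. ennreal (1 / \<bar>x\<bar>) * indicator ?I x + ennreal (1 / \<bar>- x\<bar>) * indicator ?I (- x) \<partial>lborel)"
  proof (intro nn_integral_cong)
    fix x :: real
    have "indicator {x. a \<le> \<bar>x\<bar> \<and> \<bar>x\<bar> \<le> b} x * ennreal (1 / \<bar>x\<bar>)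
        = ennreal (1 / \<bar>x\<bar>) * indicator {a..b} x + ennreal (1 / \<bar>- x\<bar>) * indicator {a..b} (- x)"
      if "0 < a" for a b
      using that by (auto simp: indicator_def abs_if)
    then show "indicator {x. exp (- m) \<le> \<bar>x\<bar> \<and> \<bar>x\<bar> \<le> exp m} x * ennreal (1 / \<bar>x\<bar>)
        = ennreal (1 / \<bar>x\<bar>) * indicator ?I x + ennreal (1 / \<bar>- x\<bar>) * indicator ?I (- x)"
      by simp
  qed
  also have "\<dots> = (\<integral>\<^sup>+ x. ennreal (1 / \<bar>x\<bar>) * indicator ?I x \<partial>lborel)
      + (\<integral>\<^sup>+ x. ennreal (1 / \<bar>- x\<bar>) * indicator ?I (- x) \<partial>lborel)"
    by (rule nn_integral_add) measurable
  also have "(\<integral>\<^sup>+ x. ennreal (1 / \<bar>- x\<bar>) * indicator ?I (- x) \<partial>lborel)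
      = (\<integral>\<^sup>+ x. ennreal (1 / \<bar>x\<bar>) * indicator ?I x \<partial>lborel)"
    using nn_integral_real_affine[of "\<lambda>x. ennreal (1 / \<bar>x\<bar>) * indicator ?I x" "-1" 0] by simp
  finally show ?thesis
    using assms by (simp add: pos flip: ennreal_plus)
qed

section \<open>The weighted problem as a convolution problem\<close>

text \<open>A multiplicative weight is, off the origin, a positive constant \<open>c\<close> times a homomorphism \<open>k\<close>
  from the nonzero reals to the positive reals.\<close>

locale multiplicative_weight =
  fixes p \<alpha> c :: real
    and v :: "real \<Rightarrow> ereal"
    and k :: "real \<Rightarrow> real"
    and \<phi> :: "real \<Rightarrow> 'a::{real_normed_field,banach,second_countable_topology}"
  assumes p: "1 < p"
    and c: "0 < c"
    and k_measurable [measurable]: "k \<in> borel_measurable lebesgue"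
    and k_pos: "x \<noteq> 0 \<Longrightarrow> 0 < k x"
    and k_mult: "x \<noteq> 0 \<Longrightarrow> y \<noteq> 0 \<Longrightarrow> k (x * y) = k x * k y"
    and v_eq: "x \<noteq> 0 \<Longrightarrow> v x = ereal (c * k x)"
    and \<phi>_measurable [measurable]: "\<phi> \<in> borel_measurable lebesgue"
begin

text \<open>The homomorphism \<open>u\<close> is chosen such that \<open>norm (f x) powr p * v x\<close> equals
  \<open>c * (norm (f x) * u x) powr p / \<bar>x\<bar>\<close>: multiplication by \<open>u\<close> turns the weighted space
  into the \<open>L^p\<close> space of Haar measure.\<close>

definition u :: "real \<Rightarrow> real" where
  "u x = (\<bar>x\<bar> * k x) powr (1 / p)"

definition kernel :: "real \<Rightarrow> real" where
  "kernel t = norm (\<phi> t) / \<bar>t\<bar> powr (2 * \<alpha> + 2) * u t"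

definition mass :: ennreal where
  "mass = (\<integral>\<^sup>+ t. ennreal (kernel t) \<partial>lebesgue)"

text \<open>The \<open>p\<close>-th power of the norm of \<open>f * u\<close> in the \<open>L^p\<close> space of Haar measure.\<close>

definition haar_integral :: "(real \<Rightarrow> 'a) \<Rightarrow> ennreal" where
  "haar_integral f = (\<integral>\<^sup>+ x. ennreal ((norm (f x) * u x) powr p) * ennreal (1 / \<bar>x\<bar>) \<partial>lebesgue)"

lemma u_pos:
  assumes "x \<noteq> 0"
  shows "0 < u x"
  using k_pos[OF assms] assms by (simp add: u_def)

lemma u_nonneg: "0 \<le> u x"
  by (simp add: u_def)

lemma u_powr:
  assumes "x \<noteq> 0"
  shows "u x powr p = \<bar>x\<bar> * k x"
  using k_pos[OF assms] p by (simp add: u_def powr_powr)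

lemma u_divide:
  assumes "x \<noteq> 0" "t \<noteq> 0"
  shows "u (x / t) = u x / u t"
proof -
  have "u x = u (x / t) * u t"
    using k_mult[of "x / t" t] k_pos assms by (simp add: u_def abs_divide flip: powr_mult)
  then show ?thesis
    using u_pos[of t] assms by simp
qed

lemma u_measurable [measurable]: "u \<in> borel_measurable lebesgue"
proof -
  note lebesgue_measurable_ident [measurable]
  show ?thesis
    unfolding u_def[abs_def] by measurable
qed

lemma kernel_measurable [measurable]: "kernel \<in> borel_measurable lebesgue"
proof -
  note lebesgue_measurable_ident [measurable]
  show ?thesis
    unfolding kernel_def[abs_def] by measurable
qed

lemma kernel_nonneg: "0 \<le> kernel t"
  by (simp add: kernel_def u_nonneg)

lemma wnorm_eq_haar_integral:
  fixes f :: "real \<Rightarrow> 'a"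
  assumes [measurable]: "f \<in> borel_measurable lebesgue"
  shows "wnorm p v f = ennreal_powr (ennreal c * haar_integral f) (1 / p)"
proof -
  note lebesgue_measurable_ident [measurable]
  have "(\<integral>\<^sup>+ x. ennreal (norm (f x) powr p) * e2ennreal (v x) \<partial>lebesgue)
      = (\<integral>\<^sup>+ x. ennreal c * (ennreal ((norm (f x) * u x) powr p) * ennreal (1 / \<bar>x\<bar>)) \<partial>lebesgue)"
  proof (rule nn_integral_cong_AE, use AE_lebesgue_nonzero in eventually_elim)
    fix x :: real assume x: "x \<noteq> 0"
    have "(norm (f x) * u x) powr p * (1 / \<bar>x\<bar>) = norm (f x) powr p * k x"
      using x u_nonneg[of x] by (simp add: powr_mult u_powr)
    then have "c * ((norm (f x) * u x) powr p * (1 / \<bar>x\<bar>)) = norm (f x) powr p * (c * k x)"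
      by simp
    then show "ennreal (norm (f x) powr p) * e2ennreal (v x)
        = ennreal c * (ennreal ((norm (f x) * u x) powr p) * ennreal (1 / \<bar>x\<bar>))"
      using x c k_pos[OF x] by (simp add: v_eq flip: ennreal_mult)
  qed
  also have "\<dots> = ennreal c * haar_integral f"
    unfolding haar_integral_def by (rule nn_integral_cmult) measurable
  finally show ?thesis
    by (simp add: wnorm_def)
qed

text \<open>Since \<open>u (x / t) = u x / u t\<close>, conjugation with \<open>u\<close> turns the Dunkl-Hausdorff operator into
  multiplicative convolution with \<open>kernel\<close>.\<close>

lemma norm_dh_integrand:
  assumes "x \<noteq> 0" "t \<noteq> 0"
  shows "norm (dh_integrand \<alpha> \<phi> f x t) = 1 / u x * (kernel t * (norm (f (x / t)) * u (x / t)))"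
  using u_pos[of x] u_pos[of t] assms by (simp add: dh_integrand_def kernel_def u_divide)

lemma wnorm_le_iff:
  fixes f :: "real \<Rightarrow> 'a"
  assumes "f \<in> borel_measurable lebesgue" "g \<in> borel_measurable lebesgue"
  shows "wnorm p v f \<le> C * wnorm p v g \<longleftrightarrow> haar_integral f \<le> ennreal_powr C p * haar_integral g"
proof -
  have "wnorm p v f \<le> C * wnorm p v g
      \<longleftrightarrow> ennreal c * haar_integral f \<le> ennreal c * (ennreal_powr C p * haar_integral g)"
    using p ennreal_powr_root_le_iff[of p "ennreal c * haar_integral f"
        "C * ennreal_powr (ennreal c * haar_integral g) (1 / p)"]
    by (simp add: wnorm_eq_haar_integral assms ennreal_powr_mult[of C] ennreal_powr_powr mult.left_commute)
  also have "\<dots> \<longleftrightarrow> haar_integral f \<le> ennreal_powr C p * haar_integral g"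
  proof
    assume "ennreal c * haar_integral f \<le> ennreal c * (ennreal_powr C p * haar_integral g)"
    then have "ennreal (1 / c) * (ennreal c * haar_integral f)
        \<le> ennreal (1 / c) * (ennreal c * (ennreal_powr C p * haar_integral g))"
      by (rule mult_left_mono) simp
    then show "haar_integral f \<le> ennreal_powr C p * haar_integral g"
      using c by (simp flip: mult.assoc ennreal_mult)
  qed (simp add: mult_left_mono)
  finally show ?thesis .
qed

lemma weighted_Lp_iff:
  fixes f :: "real \<Rightarrow> 'a"
  assumes "f \<in> borel_measurable lebesgue"
  shows "f \<in> weighted_Lp p v \<longleftrightarrow> haar_integral f < \<infinity>"
proof -
  have "wnorm p v f < \<infinity> \<longleftrightarrow> ennreal c * haar_integral f < \<infinity>"
    by (simp add: wnorm_eq_haar_integral assms ennreal_powr_def less_top)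
  also have "\<dots> \<longleftrightarrow> haar_integral f < \<infinity>"
    using c by (auto simp: ennreal_mult_less_top)
  finally show ?thesis
    using assms by (simp add: weighted_Lp_def)
qed

section \<open>The upper bound\<close>

text \<open>The convolution bound applies to the Borel versions of \<open>kernel\<close> and of \<open>norm f * u\<close>. Besides
  the norm estimate it shows that the convolution of the absolute values is finite almost everywhere,
  which is what the existence of the integral defining the operator requires.\<close>

lemma dunkl_hausdorff_bounded:
  fixes f :: "real \<Rightarrow> 'a"
  assumes fin: "mass < \<infinity>" and f: "f \<in> weighted_Lp p v"
  shows "dunkl_hausdorff_defined \<alpha> \<phi> f"
    and "dunkl_hausdorff \<alpha> \<phi> f \<in> weighted_Lp p v"
    and "wnorm p v (dunkl_hausdorff \<alpha> \<phi> f) \<le> mass * wnorm p v f"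
proof -
  have f_meas [measurable]: "f \<in> borel_measurable lebesgue"
    using f by (simp add: weighted_Lp_def)
  obtain K where [measurable]: "K \<in> borel_measurable borel" and K: "AE t in lebesgue. kernel t = K t"
    using lebesgue_measurable_ex_borel[OF kernel_measurable] .
  obtain F where [measurable]: "F \<in> borel_measurable borel"
      and F: "AE x in lebesgue. norm (f x) * u x = F x"
    by (rule lebesgue_measurable_ex_borel[of "\<lambda>x. norm (f x) * u x"]) measurable
  obtain g where [measurable]: "g \<in> borel_measurable borel" and g: "AE x in lebesgue. f x = g x"
    using lebesgue_measurable_ex_borel[OF f_meas] .
  obtain \<psi> where [measurable]: "\<psi> \<in> borel_measurable borel" and \<psi>: "AE t in lebesgue. \<phi> t = \<psi> t"
    using lebesgue_measurable_ex_borel[OF \<phi>_measurable] .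
  have [measurable]: "(\<lambda>t. dh_integrand \<alpha> \<psi> g x t) \<in> borel_measurable borel" for x
    unfolding dh_integrand_def by measurable
  have [measurable]: "case_prod (dh_integrand \<alpha> \<psi> g) \<in> borel_measurable (lborel \<Otimes>\<^sub>M lborel)"
    unfolding dh_integrand_def split_def by measurable
  have integrand_eq: "AE t in lebesgue. dh_integrand \<alpha> \<phi> f x t = dh_integrand \<alpha> \<psi> g x t" if "x \<noteq> 0" for x
    using \<psi> AE_lebesgue_divide[OF g that] by eventually_elim (simp add: dh_integrand_def)
  have integrand_meas: "dh_integrand \<alpha> \<phi> f x \<in> borel_measurable lebesgue" if "x \<noteq> 0" for x
    by (rule borel_measurable_lebesgue_cong_AE[OF _ integrand_eq[OF that]]) measurable

  define S where "S x = (\<integral>\<^sup>+ t. ennreal (\<bar>K t\<bar> * \<bar>F (x / t)\<bar>) \<partial>lborel)" for x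
  have [measurable]: "S \<in> borel_measurable borel"
    unfolding S_def[abs_def] by measurable
  have S_eq: "(\<integral>\<^sup>+ t. ennreal (norm (dh_integrand \<alpha> \<phi> f x t)) \<partial>lebesgue) = ennreal (1 / u x) * S x"
    if "x \<noteq> 0" for x
  proof -
    have "(\<integral>\<^sup>+ t. ennreal (norm (dh_integrand \<alpha> \<phi> f x t)) \<partial>lebesgue)
        = (\<integral>\<^sup>+ t. ennreal (1 / u x) * ennreal (\<bar>K t\<bar> * \<bar>F (x / t)\<bar>) \<partial>lebesgue)"
    proof (rule nn_integral_cong_AE, use AE_lebesgue_nonzero K AE_lebesgue_divide[OF F that] in eventually_elim)
      fix t :: real
      assume t: "t \<noteq> 0" "kernel t = K t" "norm (f (x / t)) * u (x / t) = F (x / t)"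
      have "\<bar>K t\<bar> = kernel t" "\<bar>F (x / t)\<bar> = norm (f (x / t)) * u (x / t)"
        using kernel_nonneg[of t] u_nonneg[of "x / t"] by (simp_all flip: t)
      then show "ennreal (norm (dh_integrand \<alpha> \<phi> f x t))
          = ennreal (1 / u x) * ennreal (\<bar>K t\<bar> * \<bar>F (x / t)\<bar>)"
        unfolding norm_dh_integrand[OF that t(1)] using u_nonneg[of x]
        by (simp flip: ennreal_mult)
    qed
    also have "\<dots> = ennreal (1 / u x) * S x"
      unfolding S_def nn_integral_completion by (rule nn_integral_cmult) measurable
    finally show ?thesis .
  qed

  have mass_eq: "(\<integral>\<^sup>+ t. ennreal \<bar>K t\<bar> \<partial>lborel) = mass"
    unfolding mass_def nn_integral_completion[symmetric, of lborel]
    by (rule nn_integral_cong_AE, use K in eventually_elim) (metis abs_of_nonneg kernel_nonneg)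
  have haar_f: "(\<integral>\<^sup>+ x. ennreal (\<bar>F x\<bar> powr p) * ennreal (1 / \<bar>x\<bar>) \<partial>lborel) = haar_integral f"
    unfolding haar_integral_def nn_integral_completion[symmetric, of lborel]
    by (rule nn_integral_cong_AE, use F in eventually_elim)
       (metis abs_of_nonneg mult_nonneg_nonneg norm_ge_zero u_nonneg)
  have bound: "(\<integral>\<^sup>+ x. ennreal_powr (S x) p * ennreal (1 / \<bar>x\<bar>) \<partial>lebesgue)
      \<le> ennreal_powr mass p * haar_integral f"
    using mult_convolution_bound[of "\<lambda>t. \<bar>K t\<bar>" "\<lambda>x. \<bar>F x\<bar>" p] p fin
    unfolding S_def[symmetric] by (simp add: mass_eq haar_f nn_integral_completion)
  have finite_rhs: "ennreal_powr mass p * haar_integral f < \<infinity>"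
    using fin f weighted_Lp_iff[OF f_meas] by (simp add: ennreal_mult_less_top ennreal_powr_less_top)
  have S_finite: "AE x in lebesgue. x \<noteq> 0 \<and> S x < \<infinity>"
  proof -
    have "AE x in lebesgue. ennreal_powr (S x) p * ennreal (1 / \<bar>x\<bar>) \<noteq> \<infinity>"
    proof (rule nn_integral_PInf_AE)
      show "(\<lambda>x. ennreal_powr (S x) p * ennreal (1 / \<bar>x\<bar>)) \<in> borel_measurable lebesgue"
        by (rule measurable_completion) measurable
      show "(\<integral>\<^sup>+ x. ennreal_powr (S x) p * ennreal (1 / \<bar>x\<bar>) \<partial>lebesgue) \<noteq> \<infinity>"
        using order.strict_trans1[OF bound finite_rhs] by simp
    qed
    then show ?thesis
      using AE_lebesgue_nonzero
    proof eventually_elim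
      fix x :: real
      assume "ennreal_powr (S x) p * ennreal (1 / \<bar>x\<bar>) \<noteq> \<infinity>" "x \<noteq> 0"
      then show "x \<noteq> 0 \<and> S x < \<infinity>"
        by (cases "S x = \<infinity>") (auto simp: ennreal_powr_def ennreal_top_mult less_top)
    qed
  qed
  have integrable: "integrable lebesgue (dh_integrand \<alpha> \<phi> f x)" if "x \<noteq> 0" "S x < \<infinity>" for x
    using that by (intro integrableI_bounded integrand_meas)
      (auto simp: S_eq ennreal_mult_less_top)
  then show defined: "dunkl_hausdorff_defined \<alpha> \<phi> f"
    using S_finite unfolding dunkl_hausdorff_defined_def by (auto elim: eventually_mono)

  have "AE x in lebesgue. dunkl_hausdorff \<alpha> \<phi> f x = (\<integral> t. dh_integrand \<alpha> \<psi> g x t \<partial>lborel)"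
    using AE_lebesgue_nonzero
  proof eventually_elim
    fix x :: real assume "x \<noteq> 0"
    then have "dunkl_hausdorff \<alpha> \<phi> f x = (LINT t|lebesgue. dh_integrand \<alpha> \<psi> g x t)"
      unfolding dunkl_hausdorff_def
      by (intro integral_cong_AE integrand_meas integrand_eq measurable_completion) auto
    then show "dunkl_hausdorff \<alpha> \<phi> f x = (\<integral> t. dh_integrand \<alpha> \<psi> g x t \<partial>lborel)"
      by (simp add: integral_completion)
  qed
  then have T_meas: "dunkl_hausdorff \<alpha> \<phi> f \<in> borel_measurable lebesgue"
    by (rule borel_measurable_lebesgue_cong_AE[rotated]) measurable

  have "haar_integral (dunkl_hausdorff \<alpha> \<phi> f)
      \<le> (\<integral>\<^sup>+ x. ennreal_powr (S x) p * ennreal (1 / \<bar>x\<bar>) \<partial>lebesgue)"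
    unfolding haar_integral_def
  proof (rule nn_integral_mono_AE, use S_finite in eventually_elim)
    fix x :: real assume x: "x \<noteq> 0 \<and> S x < \<infinity>"
    have "ennreal (norm (dunkl_hausdorff \<alpha> \<phi> f x)) \<le> ennreal (1 / u x) * S x"
      using integral_norm_bound_ennreal[OF integrable[of x]] x
      by (simp add: dunkl_hausdorff_def S_eq)
    then have "ennreal (norm (dunkl_hausdorff \<alpha> \<phi> f x)) * ennreal (u x)
        \<le> (ennreal (1 / u x) * S x) * ennreal (u x)"
      by (rule mult_right_mono) simp
    also have "ennreal (u x) * ennreal (1 / u x) = 1"
      using u_pos[of x] x by (simp flip: ennreal_mult)
    then have "(ennreal (1 / u x) * S x) * ennreal (u x) = S x"
      by (metis mult.assoc mult.commute mult.right_neutral)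
    finally have "ennreal (norm (dunkl_hausdorff \<alpha> \<phi> f x) * u x) \<le> S x"
      using u_nonneg by (simp add: ennreal_mult)
    then have "ennreal_powr (ennreal (norm (dunkl_hausdorff \<alpha> \<phi> f x) * u x)) p \<le> ennreal_powr (S x) p"
      using p by (intro ennreal_powr_mono) auto
    then show "ennreal ((norm (dunkl_hausdorff \<alpha> \<phi> f x) * u x) powr p) * ennreal (1 / \<bar>x\<bar>)
        \<le> ennreal_powr (S x) p * ennreal (1 / \<bar>x\<bar>)"
      using u_nonneg by (intro mult_right_mono) (auto simp: ennreal_powr_ennreal)
  qed
  also note bound
  finally have le: "haar_integral (dunkl_hausdorff \<alpha> \<phi> f) \<le> ennreal_powr mass p * haar_integral f" .
  then show "wnorm p v (dunkl_hausdorff \<alpha> \<phi> f) \<le> mass * wnorm p v f"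
    by (simp add: wnorm_le_iff T_meas f_meas)
  show "dunkl_hausdorff \<alpha> \<phi> f \<in> weighted_Lp p v"
    using order.strict_trans1[OF le finite_rhs] by (simp add: weighted_Lp_iff T_meas)
qed

section \<open>The lower bound\<close>

abbreviation annulus :: "real \<Rightarrow> real set" where
  "annulus m \<equiv> {x. exp (- m) \<le> \<bar>x\<bar> \<and> \<bar>x\<bar> \<le> exp m}"

definition annulus_mass :: "real \<Rightarrow> ennreal" where
  "annulus_mass m = (\<integral>\<^sup>+ t. ennreal (kernel t) * indicator (annulus m) t \<partial>lebesgue)"

lemma annulus_lebesgue [measurable]: "annulus m \<in> sets lebesgue"
  by (rule sets_completionI_sets) measurable

lemma annulus_mono:
  assumes "i \<le> j"
  shows "annulus i \<subseteq> annulus j"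
proof -
  have "exp (- j) \<le> exp (- i)" "exp i \<le> exp j"
    using assms by simp_all
  then show ?thesis
    by (smt (verit) Collect_mono_iff)
qed

lemma annulus_nonzero: "x \<in> annulus m \<Longrightarrow> x \<noteq> 0"
  using exp_gt_zero[of "- m"] by (auto simp del: exp_gt_zero)

lemma annulus_divide:
  assumes "t \<in> annulus j" "x \<in> annulus (m - j)"
  shows "x / t \<in> annulus m"
proof -
  have t: "exp (- j) \<le> \<bar>t\<bar>" "\<bar>t\<bar> \<le> exp j" and x: "exp (j - m) \<le> \<bar>x\<bar>" "\<bar>x\<bar> \<le> exp (m - j)"
    using assms by auto
  have "exp (- m) = exp (j - m) / exp j" "exp m = exp (m - j) / exp (- j)"
    by (simp_all flip: exp_diff)
  moreover have "exp (j - m) / exp j \<le> \<bar>x\<bar> / \<bar>t\<bar>"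
    using t x annulus_nonzero[OF assms(1)] by (intro frac_le) auto
  moreover have "\<bar>x\<bar> / \<bar>t\<bar> \<le> exp (m - j) / exp (- j)"
    using t x by (intro frac_le) auto
  ultimately show ?thesis
    by (simp add: abs_divide)
qed

text \<open>After multiplication by \<open>u\<close> the test functions become indicators of annuli. These are almost
  invariant under dilations, so convolution with a nonnegative kernel almost multiplies them by the
  total mass of the kernel.\<close>

definition test_function :: "real \<Rightarrow> real \<Rightarrow> 'a" where
  "test_function m x = of_real (indicator (annulus m) x / u x)"

lemma test_function_measurable [measurable]: "test_function m \<in> borel_measurable lebesgue"
  unfolding test_function_def[abs_def] by measurable

lemma norm_test_function: "norm (test_function m x) * u x = indicator (annulus m) x"
  using u_pos[OF annulus_nonzero, of x m] by (auto simp: test_function_def indicator_def norm_divide)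

lemma haar_integral_test_function:
  assumes "0 \<le> m"
  shows "haar_integral (test_function m) = ennreal (4 * m)"
proof -
  have "haar_integral (test_function m)
      = (\<integral>\<^sup>+ x. indicator (annulus m) x * ennreal (1 / \<bar>x\<bar>) \<partial>lborel)"
    unfolding haar_integral_def norm_test_function nn_integral_completion
    by (intro nn_integral_cong) (simp add: indicator_def)
  then show ?thesis
    by (simp add: nn_integral_inverse_annulus assms)
qed

text \<open>If \<open>x\<close> lies in the annulus of logarithmic radius \<open>m - j\<close>, then \<open>x / t\<close> stays in the support of the test function for
  every \<open>t\<close> in the annulus of logarithmic radius \<open>j\<close>, so the convolution collects at least the mass of
  the kernel on that annulus. The integrand is a nonnegative real multiple of one, hence the norm of the
  integral is the integral of the norm.\<close>

lemma norm_dunkl_hausdorff_test_function: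
  assumes "integrable lebesgue (dh_integrand \<alpha> \<phi> (test_function m) x)" "x \<in> annulus (m - j)"
  shows "annulus_mass j \<le> ennreal (norm (dunkl_hausdorff \<alpha> \<phi> (test_function m) x) * u x)"
proof -
  have x: "x \<noteq> 0"
    using assms(2) by (rule annulus_nonzero)
  let ?I = "dh_integrand \<alpha> \<phi> (test_function m) x"
  have "?I = (\<lambda>t. of_real (norm (?I t)))"
  proof
    fix t
    define r where "r = norm (\<phi> t) / \<bar>t\<bar> powr (2 * \<alpha> + 2) * (indicator (annulus m) (x / t) / u (x / t))"
    have "?I t = of_real r" "0 \<le> r"
      using u_nonneg[of "x / t"] by (simp_all add: dh_integrand_def test_function_def scaleR_conv_of_real r_def)
    then show "?I t = of_real (norm (?I t))"
      by simp
  qed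
  then have "dunkl_hausdorff \<alpha> \<phi> (test_function m) x = of_real (LINT t|lebesgue. norm (?I t))"
    unfolding dunkl_hausdorff_def
    using integral_bounded_linear[OF bounded_linear_of_real[where 'a='a] integrable_norm[OF assms(1)]]
    by simp
  then have "ennreal (norm (dunkl_hausdorff \<alpha> \<phi> (test_function m) x))
      = (\<integral>\<^sup>+ t. ennreal (norm (?I t)) \<partial>lebesgue)"
    using assms(1) by (simp add: nn_integral_eq_integral)
  also have "\<dots> = (\<integral>\<^sup>+ t. ennreal (1 / u x) * (ennreal (kernel t) * indicator (annulus m) (x / t)) \<partial>lebesgue)"
  proof (rule nn_integral_cong_AE, use AE_lebesgue_nonzero in eventually_elim)
    fix t :: real assume "t \<noteq> 0"
    then show "ennreal (norm (?I t)) = ennreal (1 / u x) * (ennreal (kernel t) * indicator (annulus m) (x / t))"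
      using u_nonneg[of x] kernel_nonneg[of t]
      by (subst norm_dh_integrand[OF x]) (auto simp: norm_test_function indicator_def simp flip: ennreal_mult)
  qed
  also have "\<dots> \<ge> (\<integral>\<^sup>+ t. ennreal (1 / u x) * (ennreal (kernel t) * indicator (annulus j) t) \<partial>lebesgue)"
    using annulus_divide[OF _ assms(2)]
    by (intro nn_integral_mono mult_left_mono) (auto simp: indicator_def)
  also have "(\<integral>\<^sup>+ t. ennreal (1 / u x) * (ennreal (kernel t) * indicator (annulus j) t) \<partial>lebesgue)
      = ennreal (1 / u x) * annulus_mass j"
    unfolding annulus_mass_def by (rule nn_integral_cmult) measurable
  finally have "ennreal (u x) * (ennreal (1 / u x) * annulus_mass j)
      \<le> ennreal (u x) * ennreal (norm (dunkl_hausdorff \<alpha> \<phi> (test_function m) x))"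
    by (intro mult_left_mono) auto
  then show ?thesis
    using u_pos[OF x] by (simp add: mult.commute[of "u x"] flip: mult.assoc ennreal_mult)
qed

text \<open>Comparing the norms of \<open>test_function m\<close> and of its image, where the image is only
  estimated from below on the annulus of logarithmic radius \<open>m - j\<close>.\<close>

lemma annulus_mass_test_inequality:
  assumes C: "\<And>f. f \<in> weighted_Lp p v \<Longrightarrow> dunkl_hausdorff_defined \<alpha> \<phi> f
      \<and> dunkl_hausdorff \<alpha> \<phi> f \<in> weighted_Lp p v
      \<and> wnorm p v (dunkl_hausdorff \<alpha> \<phi> f) \<le> C * wnorm p v f"
    and "0 \<le> j" "j \<le> m"
  shows "ennreal_powr (annulus_mass j) p * ennreal (4 * (m - j)) \<le> ennreal_powr C p * ennreal (4 * m)"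
proof -
  let ?T = "dunkl_hausdorff \<alpha> \<phi> (test_function m)"
  have "test_function m \<in> weighted_Lp p v"
    using assms by (simp add: weighted_Lp_iff haar_integral_test_function)
  note T = C[OF this]
  have "ennreal_powr (annulus_mass j) p * ennreal (4 * (m - j))
      = ennreal_powr (annulus_mass j) p
        * (\<integral>\<^sup>+ x. indicator (annulus (m - j)) x * ennreal (1 / \<bar>x\<bar>) \<partial>lborel)"
    using assms by (subst nn_integral_inverse_annulus) auto
  also have "\<dots> = (\<integral>\<^sup>+ x. ennreal_powr (annulus_mass j) p
      * (indicator (annulus (m - j)) x * ennreal (1 / \<bar>x\<bar>)) \<partial>lborel)"
    by (rule nn_integral_cmult[symmetric]) measurable
  also have "\<dots> = (\<integral>\<^sup>+ x. ennreal_powr (annulus_mass j) p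
      * (indicator (annulus (m - j)) x * ennreal (1 / \<bar>x\<bar>)) \<partial>lebesgue)"
    by (simp only: nn_integral_completion)
  also have "\<dots> \<le> haar_integral ?T"
    unfolding haar_integral_def
  proof (rule nn_integral_mono_AE)
    have "AE x in lebesgue. integrable lebesgue (dh_integrand \<alpha> \<phi> (test_function m) x)"
      using T by (simp add: dunkl_hausdorff_defined_def)
    then show "AE x in lebesgue. ennreal_powr (annulus_mass j) p
        * (indicator (annulus (m - j)) x * ennreal (1 / \<bar>x\<bar>))
        \<le> ennreal ((norm (?T x) * u x) powr p) * ennreal (1 / \<bar>x\<bar>)"
    proof eventually_elim
      fix x assume int: "integrable lebesgue (dh_integrand \<alpha> \<phi> (test_function m) x)"
      show "ennreal_powr (annulus_mass j) p * (indicator (annulus (m - j)) x * ennreal (1 / \<bar>x\<bar>))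
          \<le> ennreal ((norm (?T x) * u x) powr p) * ennreal (1 / \<bar>x\<bar>)"
      proof (cases "x \<in> annulus (m - j)")
        case True
        have "ennreal_powr (annulus_mass j) p \<le> ennreal_powr (ennreal (norm (?T x) * u x)) p"
          using norm_dunkl_hausdorff_test_function[OF int True] p by (intro ennreal_powr_mono) auto
        then show ?thesis
          unfolding indicator_simps(1)[OF True]
          using u_nonneg[of x] by (simp add: ennreal_powr_ennreal mult_right_mono)
      next
        case False
        show ?thesis
          unfolding indicator_simps(2)[OF False] by simp
      qed
    qed
  qed
  also have "\<dots> \<le> ennreal_powr C p * haar_integral (test_function m)"
    using T by (subst wnorm_le_iff[symmetric]) (auto simp: weighted_Lp_def)
  finally show ?thesis
    using assms by (simp add: haar_integral_test_function)
qed

text \<open>Dividing the inequality \<open>annulus_mass j powr p * (m - j) \<le> C powr p * m\<close> by \<open>m\<close> and letting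
  \<open>m\<close> tend to infinity gives \<open>annulus_mass j \<le> C\<close>; then \<open>j\<close> tends to infinity.\<close>

lemma mass_le_admissible_constant:
  assumes C: "\<And>f. f \<in> weighted_Lp p v \<Longrightarrow> dunkl_hausdorff_defined \<alpha> \<phi> f
      \<and> dunkl_hausdorff \<alpha> \<phi> f \<in> weighted_Lp p v
      \<and> wnorm p v (dunkl_hausdorff \<alpha> \<phi> f) \<le> C * wnorm p v f"
  shows "mass \<le> C"
proof (cases "C = \<infinity>")
  case False
  then obtain r where r: "C = ennreal r" "0 \<le> r"
    by (cases C) auto
  have annulus_le: "annulus_mass j \<le> C" if j: "0 \<le> j" for j
  proof -
    have ineq: "ennreal_powr (annulus_mass j) p * ennreal (4 * (m - j)) \<le> ennreal (r powr p * (4 * m))"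
      if "j \<le> m" for m
      using annulus_mass_test_inequality[OF C j that] r j that
      by (simp add: ennreal_powr_ennreal ennreal_mult)
    have "annulus_mass j \<noteq> \<infinity>"
      using ineq[of "j + 1"] by (auto simp: ennreal_powr_def ennreal_top_mult top_unique)
    then obtain a where a: "annulus_mass j = ennreal a" "0 \<le> a"
      by (cases "annulus_mass j") auto
    have real_ineq: "a powr p * (m - j) \<le> r powr p * m" if "j \<le> m" for m
    proof -
      have "a powr p * (4 * (m - j)) \<le> r powr p * (4 * m)"
        using ineq[OF that] a r j that
        by (simp add: ennreal_powr_ennreal del: right_diff_distrib_numeral flip: ennreal_mult)
      then show ?thesis
        by (simp add: algebra_simps)
    qed
    have "a \<le> r"
    proof (rule ccontr)
      assume "\<not> a \<le> r"
      then have d: "0 < a powr p - r powr p"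
        using p r by (simp add: powr_less_mono2)
      \<comment> \<open>The inequality \<open>a powr p * (m - j) \<le> r powr p * m\<close> bounds \<open>m\<close> by
        \<open>j * a powr p / (a powr p - r powr p)\<close>; this \<open>m\<close> exceeds the bound and is at least \<open>j\<close>.\<close>
      define m where "m = j + 1 + j * a powr p / (a powr p - r powr p)"
      have "j \<le> m"
        using d j by (simp add: m_def)
      have "m * (a powr p - r powr p) \<le> j * a powr p"
        using real_ineq[OF \<open>j \<le> m\<close>] by (simp add: algebra_simps)
      moreover have "m * (a powr p - r powr p) = (j + 1) * (a powr p - r powr p) + j * a powr p"
        using d by (simp add: m_def distrib_right)
      moreover have "0 < (j + 1) * (a powr p - r powr p)"
        using d j by (intro mult_pos_pos) auto
      ultimately show False
        by linarith
    qed
    then show ?thesis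
      using a r by (simp add: ennreal_leI)
  qed
  have "mass = (\<integral>\<^sup>+ t. (SUP n. ennreal (kernel t) * indicator (annulus (real n)) t) \<partial>lebesgue)"
    unfolding mass_def
  proof (rule nn_integral_cong_AE, use AE_lebesgue_nonzero in eventually_elim)
    fix t :: real assume "t \<noteq> 0"
    obtain n :: nat where n: "\<bar>ln \<bar>t\<bar>\<bar> \<le> real n"
      using real_arch_simple by blast
    then have "exp (- real n) \<le> exp (ln \<bar>t\<bar>)" "exp (ln \<bar>t\<bar>) \<le> exp (real n)"
      unfolding exp_le_cancel_iff by linarith+
    then have "t \<in> annulus (real n)"
      using \<open>t \<noteq> 0\<close> by simp
    then have "ennreal (kernel t) \<le> (SUP n. ennreal (kernel t) * indicator (annulus (real n)) t)"
      by (intro SUP_upper2[of n]) (simp_all add: indicator_def)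
    moreover have "(SUP n. ennreal (kernel t) * indicator (annulus (real n)) t) \<le> ennreal (kernel t)"
      by (intro SUP_least) (simp add: indicator_def)
    ultimately show "ennreal (kernel t) = (SUP n. ennreal (kernel t) * indicator (annulus (real n)) t)"
      by (rule antisym)
  qed
  also have "\<dots> = (SUP n. annulus_mass (real n))"
    unfolding annulus_mass_def
  proof (rule nn_integral_monotone_convergence_SUP)
    have "x \<in> annulus (real n) \<Longrightarrow> x \<in> annulus (real (Suc n))" for x n
      by (erule subsetD[OF annulus_mono, rotated]) simp
    then show "incseq (\<lambda>n t. ennreal (kernel t) * indicator (annulus (real n)) t)"
      by (intro incseq_SucI le_funI mult_left_mono indicator_leI) (blast | rule zero_le)+
    show "(\<lambda>t. ennreal (kernel t) * indicator (annulus (real n)) t) \<in> borel_measurable lebesgue" for n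
      by measurable
  qed
  also have "\<dots> \<le> C"
    by (intro SUP_least annulus_le) simp
  finally show ?thesis .
qed simp

theorem dunkl_hausdorff_norm_eq_mass: "dunkl_hausdorff_norm p v \<alpha> \<phi> = mass"
  unfolding dunkl_hausdorff_norm_def weighted_op_norm_def
proof (rule antisym)
  show "Inf {C. \<forall>f\<in>weighted_Lp p v. dunkl_hausdorff_defined \<alpha> \<phi> f
      \<and> dunkl_hausdorff \<alpha> \<phi> f \<in> weighted_Lp p v
      \<and> wnorm p v (dunkl_hausdorff \<alpha> \<phi> f) \<le> C * wnorm p v f} \<le> mass"
  proof (cases "mass = \<infinity>")
    case False
    then show ?thesis
      using dunkl_hausdorff_bounded by (intro Inf_lower) (auto simp: less_top)
  qed simp
  show "mass \<le> Inf {C. \<forall>f\<in>weighted_Lp p v. dunkl_hausdorff_defined \<alpha> \<phi> f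
      \<and> dunkl_hausdorff \<alpha> \<phi> f \<in> weighted_Lp p v
      \<and> wnorm p v (dunkl_hausdorff \<alpha> \<phi> f) \<le> C * wnorm p v f}"
    using mass_le_admissible_constant by (intro Inf_greatest) blast
qed

end


section \<open>Weights satisfying the functional equation\<close>

text \<open>Where \<open>v a\<close> is finite and positive, \<open>v a = v x * h (a / x)\<close> forces \<open>v x\<close> to be finite and
  nonzero for every \<open>x \<noteq> 0\<close>, so \<open>v / v 1\<close> is a real homomorphism that equals \<open>h\<close>. It is positive at
  squares, hence on the positive half-line; because \<open>v\<close> is positive almost everywhere, it is also
  positive at some negative number, and therefore at all of them. At the origin \<open>v\<close> and \<open>h\<close> may
  take arbitrary compatible extended values.\<close>

lemma multiplicative_ereal_weight:
  fixes v h :: "real \<Rightarrow> ereal"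
  assumes weight: "weight_function v"
    and mult: "\<And>x y. v (x * y) = v x * h y"
  obtains c k where "0 < c" "k \<in> borel_measurable lebesgue"
    "\<And>x. x \<noteq> 0 \<Longrightarrow> 0 < k x" "\<And>x y. x \<noteq> 0 \<Longrightarrow> y \<noteq> 0 \<Longrightarrow> k (x * y) = k x * k y"
    "\<And>x. x \<noteq> 0 \<Longrightarrow> v x = ereal (c * k x)" "\<And>x. x \<noteq> 0 \<Longrightarrow> h x = ereal (k x)"
proof -
  have ae: "AE x in lebesgue. 0 < v x \<and> v x < \<infinity>" and [measurable]: "v \<in> borel_measurable lebesgue"
    using weight by (simp_all add: weight_function_def)
  obtain a where a: "0 < a" "0 < v a" "v a < \<infinity>"
    by (rule AE_lebesgue_imp_ex_open[OF ae, of "{0<..}"]) auto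
  obtain b where b: "b < 0" "0 < v b" "v b < \<infinity>"
    by (rule AE_lebesgue_imp_ex_open[OF ae, of "{..<0}"]) auto
  define w where "w x = real_of_ereal (v x)" for x
  define k where "k x = w x / w 1" for x
  obtain r where r: "v a = ereal r" "0 < r"
    using a by (cases "v a") auto
  have v_eq: "v x = ereal (w x)" and w_nonzero: "w x \<noteq> 0" if "x \<noteq> 0" for x
  proof -
    have "ereal r = v x * h (a / x)"
      using mult[of x "a / x"] that r by simp
    then have "v x = ereal (w x) \<and> w x \<noteq> 0"
      using r(2) by (cases "v x"; cases "h (a / x)") (auto simp: w_def split: if_splits)
    then show "v x = ereal (w x)" "w x \<noteq> 0"
      by auto
  qed
  have h_eq: "h x = ereal (k x)" if "x \<noteq> 0" for x
    using mult[of 1 x] v_eq[OF that] v_eq[of 1] w_nonzero[of 1] w_nonzero[OF that]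
    by (cases "h x") (auto simp: k_def split: if_splits)
  have k_mult: "k (x * y) = k x * k y" if "x \<noteq> 0" "y \<noteq> 0" for x y
    using mult[of x y] that v_eq[of x] v_eq[of "x * y"] h_eq[of y] by (simp add: k_def)
  have k_nonzero: "k x \<noteq> 0" if "x \<noteq> 0" for x
    using w_nonzero[OF that] w_nonzero[of 1] by (simp add: k_def)
  have w_eq: "w x = w 1 * k x" for x
    using w_nonzero[of 1] by (simp add: k_def)
  have k_pos_pos: "0 < k x" if "0 < x" for x
  proof -
    have "k x = k (sqrt x) * k (sqrt x)"
      using k_mult[of "sqrt x" "sqrt x"] that by simp
    then show ?thesis
      using k_nonzero[of "sqrt x"] that by (auto simp: zero_less_mult_iff)
  qed
  have w1_pos: "0 < w 1"
    using a v_eq[of a] w_eq[of a] k_pos_pos[of a] by (auto simp: zero_less_mult_iff)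
  have "0 < k b"
    using b v_eq[of b] w_eq[of b] w1_pos by (auto simp: zero_less_mult_iff)
  have k_pos: "0 < k x" if "x \<noteq> 0" for x
  proof (cases "0 < x")
    case False
    then have "k x = k (x / b) * k b"
      using k_mult[of "x / b" b] that b by simp
    moreover have "0 < k (x / b)"
      using False that b by (intro k_pos_pos divide_neg_neg) auto
    ultimately show ?thesis
      using \<open>0 < k b\<close> by simp
  qed (rule k_pos_pos)
  show ?thesis
  proof
    show "k \<in> borel_measurable lebesgue"
      unfolding k_def[abs_def] w_def[abs_def] by measurable
    show "v x = ereal (w 1 * k x)" if "x \<noteq> 0" for x
      using v_eq[OF that] w_eq[of x] by simp
  qed (use w1_pos k_pos k_mult h_eq in auto)
qed

text \<open>The quotients in both constants reduce to \<open>h t\<close>, and the remaining claim is that \<open>kernel\<close>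
  is the integrand built from \<open>h\<close>.\<close>

theorem corollary2p4:
  fixes p \<alpha> :: real
    and v h :: "real \<Rightarrow> ereal"
    and \<phi> :: "real \<Rightarrow> 'a::{real_normed_field,banach,second_countable_topology}"
  assumes "1 < p"
    and "weight_function v"
    and "integrable lebesgue \<phi>"
    and "\<forall>x y. v (x * y) = v x * h y"
  shows "A_sup p v \<alpha> \<phi> = A_inf p v \<alpha> \<phi> \<and>
         dunkl_hausdorff_norm p v \<alpha> \<phi> =
           (\<integral>\<^sup>+ t. ennreal (norm (\<phi> t) / \<bar>t\<bar> powr (2 * \<alpha> + 2 - 1 / p))
                  * ennreal_powr (e2ennreal (h t)) (1 / p) \<partial>lebesgue)"
proof
  have mult: "v (x * y) = v x * h y" for x y
    using assms(4) by blast
  obtain c k where ck: "0 < c" "k \<in> borel_measurable lebesgue"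
    "\<And>x. x \<noteq> 0 \<Longrightarrow> 0 < k x" "\<And>x y. x \<noteq> 0 \<Longrightarrow> y \<noteq> 0 \<Longrightarrow> k (x * y) = k x * k y"
    "\<And>x. x \<noteq> 0 \<Longrightarrow> v x = ereal (c * k x)" "\<And>x. x \<noteq> 0 \<Longrightarrow> h x = ereal (k x)"
    using multiplicative_ereal_weight[OF assms(2) mult] by blast
  interpret multiplicative_weight p \<alpha> c v k \<phi>
    by standard (use assms ck in auto)

  let ?Y = "{y. 0 < v y \<and> v y < \<infinity>}"
  have quotient: "v (t * y) / v y = h t" if "y \<in> ?Y" for t y
  proof -
    have "0 < v y" "v y < \<infinity>"
      using that by auto
    then obtain r where "v y = ereal r" "0 < r"
      by (cases "v y") auto
    then show ?thesis
      using mult[of y t] by (cases "h t") (auto simp: mult.commute[of t])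
  qed
  have "1 \<in> ?Y"
    using ck by simp
  then have "?Y \<noteq> {}"
    by blast
  then have "(SUP y\<in>?Y. v (t * y) / v y) = h t" "(INF y\<in>?Y. v (t * y) / v y) = h t" for t
    using quotient by (auto intro!: SUP_eq_const INF_eq_const)
  then show "A_sup p v \<alpha> \<phi> = A_inf p v \<alpha> \<phi>"
    unfolding A_sup_def A_inf_def by presburger

  have "mass = (\<integral>\<^sup>+ t. ennreal (norm (\<phi> t) / \<bar>t\<bar> powr (2 * \<alpha> + 2 - 1 / p))
      * ennreal_powr (e2ennreal (h t)) (1 / p) \<partial>lebesgue)"
    unfolding mass_def
  proof (rule nn_integral_cong_AE, use AE_lebesgue_nonzero in eventually_elim)
    fix t :: real assume t: "t \<noteq> 0"
    have "kernel t = norm (\<phi> t) / \<bar>t\<bar> powr (2 * \<alpha> + 2 - 1 / p) * k t powr (1 / p)"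
      using t ck(3)[OF t] by (simp add: kernel_def u_def powr_mult powr_diff)
    then show "ennreal (kernel t) = ennreal (norm (\<phi> t) / \<bar>t\<bar> powr (2 * \<alpha> + 2 - 1 / p))
        * ennreal_powr (e2ennreal (h t)) (1 / p)"
      using ck(3,6)[OF t] by (simp add: ennreal_powr_ennreal flip: ennreal_mult)
  qed
  then show "dunkl_hausdorff_norm p v \<alpha> \<phi> =
      (\<integral>\<^sup>+ t. ennreal (norm (\<phi> t) / \<bar>t\<bar> powr (2 * \<alpha> + 2 - 1 / p))
         * ennreal_powr (e2ennreal (h t)) (1 / p) \<partial>lebesgue)"
    by (simp only: dunkl_hausdorff_norm_eq_mass)
qed

end
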